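(* Let $n\ge d\ge 1$, $t_0\in\mathbb{R}$, and let $f\in\mathcal{F}(m_f,L_f)$ on $\mathbb{R}^d$. Let $A(t)\in\mathbb{R}^{n\times n}$, $B(t)\in\mathbb{R}^{n\times d}$, $C(t)\in\mathbb{R}^{d\times n}$ be defined for $t\ge t_0$, with $C$ differentiable, and let $\xi\colon[t_0,\infty)\to\mathbb{R}^n$ be a differentiable solution of $$\dot\xi(t)=A(t)\xi(t)+B(t)u(t),\quad y(t)=C(t)\xi(t),\quad u(t)=\nabla f(y(t))\qquad\text{for all }t\ge t_0 .$$ Let $\xi_\star\in\mathbb{R}^n$ and $y_\star,u_\star\in\mathbb{R}^d$ satisfy, for all $t\ge t_0$, $0=A(t)\xi_\star$, $y_\star=C(t)\xi_\star$, $u_\star=\nabla f(y_\star)=0$. Suppose there exist a differentiable nondecreasing $a\colon[t_0,\infty)\to[0,\infty)$, a differentiable $P\colon[t_0,\infty)\to\mathbb{S}^n_+$, and a continuous $\sigma\colon[t_0,\infty)\to[0,\infty)$ such that $$M_0(t)+a(t)M_1(t)+\dot a(t)M_2(t)+\sigma(t)M_3(t)\preceq 0\qquad\text{for all }t\ge t_0,$$ where $$M_0(t)=\begin{bmatrix}P(t)A(t)+A(t)^\top P(t)+\dot P(t) & P(t)B(t)\\ B(t)^\top P(t) & 0\end{bmatrix},$$ $$M_1(t)=\frac12\begin{bmatrix}0 & (C(t)A(t)+\dot C(t))^\top\\ C(t)A(t)+\dot C(t) & C(t)B(t)+B(t)^\top C(t)^\top\end{bmatrix},$$ $$M_2(t)=\begin{bmatrix}C(t)^\top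 & 0\\ 0& I_d\end{bmatrix}\begin{bmatrix}-\frac{m_f}{2}I_d & \frac12I_d\\ \frac12I_d & 0\end{bmatrix}\begin{bmatrix}C(t) & 0\\ 0& I_d\end{bmatrix},$$ $$M_3(t)=\begin{bmatrix}C(t)^\top & 0\\ 0& I_d\end{bmatrix}\begin{bmatrix}-\frac{m_fL_f}{m_f+L_f}I_d & \frac12I_d\\ \frac12I_d & -\frac{1}{m_f+L_f}I_d\end{bmatrix}\begin{bmatrix}C(t) & 0\\ 0& I_d\end{bmatrix}.$$ Then for all $t\ge t_0$ with $a(t)>0$, $$f(y(t))-f(y_\star)\le\frac{a(t_0)\,(f(y(t_0))-f(y_\star))+(\xi(t_0)-\xi_\star)^\top P(t_0)(\xi(t_0)-\xi_\star)}{a(t)} .$$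
   Context: For $0\le m_f\le L_f<\infty$ with $L_f>0$, $\mathcal{F}(m_f,L_f)$ denotes the class of differentiable functions $f\colon\mathbb{R}^d\to\mathbb{R}$ that are $L_f$-smooth, i.e. $\|\nabla f(x)-\nabla f(y)\|_2\le L_f\|x-y\|_2$ for all $x,y\in\mathbb{R}^d$, and $m_f$-strongly convex, i.e. $m_f\|x-y\|_2^2\le(x-y)^\top(\nabla f(x)-\nabla f(y))$ for all $x,y\in\mathbb{R}^d$ ($m_f=0$ means convex). $\mathbb{S}^n_+$ is the set of real symmetric positive semidefinite $n\times n$ matrices, $I_d$ is the $d\times d$ identity, a dot denotes the derivative in $t$ (one-sided at $t_0$), and $M\preceq0$ means $M$ is negative semidefinite. *)

theory Defs
  imports "HOL-Analysis.Analysis"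
begin

definition gradient :: "('a::real_inner \<Rightarrow> real) \<Rightarrow> 'a \<Rightarrow> 'a" where
  "gradient f x = (THE D. GDERIV f x :> D)"

lemma gradient_eqI:
  assumes "GDERIV f x :> D"
  shows "gradient f x = D"
  unfolding gradient_def
proof (rule the_equality)
  show "GDERIV f x :> D" by (rule assms)
next
  fix E assume "GDERIV f x :> E"
  then have "(\<lambda>h. inner h E) = (\<lambda>h. inner h D)"
    using assms unfolding gderiv_def by (rule has_derivative_unique)
  then have "\<And>h. inner h (E - D) = 0"
    by (simp add: inner_diff_right fun_eq_iff)
  then show "E = D" by (metis inner_eq_zero_iff right_minus_eq)
qed

lemma GDERIV_gradient:
  fixes f :: "'a::euclidean_space \<Rightarrow> real"
  assumes "f differentiable (at x)"
  shows "GDERIV f x :> gradient f x"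
proof -
  obtain f' where f': "(f has_derivative f') (at x)"
    using assms by (auto simp: differentiable_def)
  interpret linear f' using f' by (rule has_derivative_linear)
  have "f' h = inner h (adjoint f' 1)" for h
    using adjoint_works[OF linear_axioms, of h 1] by simp
  then have "f' = (\<lambda>h. inner h (adjoint f' 1))" by blast
  then have "GDERIV f x :> adjoint f' 1"
    using f' by (simp add: gderiv_def)
  then show ?thesis by (simp add: gradient_eqI)
qed

definition smooth_strongly_convex :: "real \<Rightarrow> real \<Rightarrow> (real ^ 'd \<Rightarrow> real) set" where
  "smooth_strongly_convex m L = {f.
     (\<forall>x. f differentiable (at x)) \<and>
     (\<forall>x y. norm (gradient f x - gradient f y) \<le> L * norm (x - y)) \<and>
     (\<forall>x y. m * (norm (x - y))\<^sup>2 \<le> (x - y) \<bullet> (gradient f x - gradient f y))}"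

definition pos_semidef :: "real ^ 'n ^ 'n \<Rightarrow> bool" where
  "pos_semidef M \<longleftrightarrow> transpose M = M \<and> (\<forall>x. 0 \<le> x \<bullet> (M *v x))"

definition neg_semidef :: "real ^ 'n ^ 'n \<Rightarrow> bool" where
  "neg_semidef M \<longleftrightarrow> transpose M = M \<and> (\<forall>x. x \<bullet> (M *v x) \<le> 0)"

text \<open>The block matrix with rows \<open>[M11 M12]\<close> and \<open>[M21 M22]\<close>: the block sizes add up, so rows
  and columns are indexed by sum types.\<close>

definition block :: "'a ^ 'k ^ 'n \<Rightarrow> 'a ^ 'l ^ 'n \<Rightarrow> 'a ^ 'k ^ 'm \<Rightarrow> 'a ^ 'l ^ 'm
    \<Rightarrow> 'a ^ ('k + 'l) ^ ('n + 'm)" where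
  "block M11 M12 M21 M22 = (\<chi> i j.
     case i of
       Inl i1 \<Rightarrow> (case j of Inl j1 \<Rightarrow> M11 $ i1 $ j1 | Inr j2 \<Rightarrow> M12 $ i1 $ j2)
     | Inr i2 \<Rightarrow> (case j of Inl j1 \<Rightarrow> M21 $ i2 $ j1 | Inr j2 \<Rightarrow> M22 $ i2 $ j2))"

text \<open>The four matrices of the linear matrix inequality at a fixed time; \<open>dP\<close> and \<open>dC\<close> stand
  for the time derivatives of \<open>P\<close> and \<open>C\<close>.\<close>

definition M0 :: "real ^ 'n ^ 'n \<Rightarrow> real ^ 'd ^ 'n \<Rightarrow> real ^ 'n ^ 'n \<Rightarrow> real ^ 'n ^ 'n
    \<Rightarrow> real ^ ('n + 'd) ^ ('n + 'd)" where
  "M0 A B P dP =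
     block (P ** A + transpose A ** P + dP) (P ** B)
           (transpose B ** P)               0"

definition M1 :: "real ^ 'n ^ 'n \<Rightarrow> real ^ 'd ^ 'n \<Rightarrow> real ^ 'n ^ 'd \<Rightarrow> real ^ 'n ^ 'd
    \<Rightarrow> real ^ ('n + 'd) ^ ('n + 'd)" where
  "M1 A B C dC = (1/2) *\<^sub>R
     block 0             (transpose (C ** A + dC))
           (C ** A + dC) (C ** B + transpose B ** transpose C)"

definition M2 :: "real \<Rightarrow> real ^ 'n ^ 'd \<Rightarrow> real ^ ('n + 'd) ^ ('n + 'd)" where
  "M2 m C =
     block (transpose C) 0
           0             (mat 1 :: real ^ 'd ^ 'd) **
     block ((- (m/2)) *\<^sub>R (mat 1 :: real ^ 'd ^ 'd)) ((1/2) *\<^sub>R mat 1)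
           ((1/2) *\<^sub>R mat 1)                         (0 :: real ^ 'd ^ 'd) **
     block C 0
           0 (mat 1 :: real ^ 'd ^ 'd)"

definition M3 :: "real \<Rightarrow> real \<Rightarrow> real ^ 'n ^ 'd \<Rightarrow> real ^ ('n + 'd) ^ ('n + 'd)" where
  "M3 m L C =
     block (transpose C) 0
           0             (mat 1 :: real ^ 'd ^ 'd) **
     block ((- (m * L / (m + L))) *\<^sub>R (mat 1 :: real ^ 'd ^ 'd)) ((1/2) *\<^sub>R mat 1)
           ((1/2) *\<^sub>R mat 1) ((- (1 / (m + L))) *\<^sub>R (mat 1 :: real ^ 'd ^ 'd)) **
     block C 0
           0 (mat 1 :: real ^ 'd ^ 'd)"

end

theory Submission
  imports Defs
begin

text \<open>The energy \<open>V t = a t * (f (y t) - f ys) + (\<xi> t - \<xi>s) \<bullet> (P t *v (\<xi> t - \<xi>s))\<close> is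
  nonincreasing, and its second summand is nonnegative. Evaluate the linear matrix inequality on
  the stacked vector \<open>(\<xi> t - \<xi>s, u t)\<close>: the forms of \<open>M0\<close> and \<open>M1\<close> give exactly the derivative of
  the quadratic term and of \<open>f (y t)\<close>, the form of \<open>M2\<close> dominates \<open>f (y t) - f ys\<close> by strong
  convexity, and the form of \<open>M3\<close> is nonnegative by cocoercivity of the gradient.\<close>

section \<open>Gradients of smooth and strongly convex functions\<close>

lemma GDERIV_line:
  assumes "GDERIV f (x + s *\<^sub>R d) :> D"
  shows "((\<lambda>s. f (x + s *\<^sub>R d)) has_real_derivative D \<bullet> d) (at s)"
proof -
  have "((\<lambda>s. x + s *\<^sub>R d) has_derivative (\<lambda>h. h *\<^sub>R d)) (at s)"
    by (auto intro!: derivative_eq_intros)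
  from has_derivative_compose[OF this assms[unfolded gderiv_def]]
  show ?thesis
    by (rule has_derivative_imp_has_field_derivative) (simp add: inner_commute)
qed

text \<open>Along the segment from \<open>x\<close> to \<open>y\<close>, \<open>f\<close> minus the
  claimed bound is, up to a constant, a function of one variable with nonpositive derivative. The
  sign of \<open>c\<close> is left free, so that negating \<open>f\<close> yields a lower
  bound.\<close>

lemma quadratic_upper_bound:
  fixes f :: "'a::real_inner \<Rightarrow> real"
  assumes grad: "\<And>x. GDERIV f x :> g x"
    and bound: "\<And>x y. (x - y) \<bullet> (g x - g y) \<le> c * (norm (x - y))\<^sup>2"
  shows "f y \<le> f x + g x \<bullet> (y - x) + c / 2 * (norm (y - x))\<^sup>2"
proof -
  define d where "d = y - x"
  define \<psi> where "\<psi> s = f (x + s *\<^sub>R d) - s * (g x \<bullet> d) - c / 2 * s\<^sup>2 * (norm d)\<^sup>2" for s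
  have deriv: "(\<psi> has_real_derivative g (x + s *\<^sub>R d) \<bullet> d - g x \<bullet> d - c * s * (norm d)\<^sup>2) (at s)" for s
    unfolding \<psi>_def by (rule derivative_eq_intros GDERIV_line[OF grad] refl | simp)+
  have nonpos: "g (x + s *\<^sub>R d) \<bullet> d - g x \<bullet> d - c * s * (norm d)\<^sup>2 \<le> 0" if "0 < s" for s
  proof -
    \<comment> \<open>The two points differ by \<open>s *\<^sub>R d\<close>, so \<open>bound\<close>
      carries \<open>s\<close> on the left and \<open>s\<^sup>2\<close> on the right; one positive
      factor \<open>s\<close> cancels.\<close>
    have "s * ((g (x + s *\<^sub>R d) - g x) \<bullet> d) \<le> s * (c * s * (norm d)\<^sup>2)"
      using bound[of "x + s *\<^sub>R d" x]
      by (simp add: inner_commute power_mult_distrib power2_eq_square mult_ac)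
    then show ?thesis
      using that by (simp add: inner_diff_left)
  qed
  have "\<psi> 1 \<le> \<psi> 0"
  proof (rule DERIV_nonpos_imp_decreasing_open[of 0 1])
    show "continuous_on {0..1} \<psi>"
      using deriv DERIV_isCont by (blast intro: continuous_at_imp_continuous_on)
  qed (use deriv nonpos in \<open>force+\<close>)
  then show ?thesis
    by (simp add: \<psi>_def d_def)
qed

text \<open>This is the upper bound for \<open>- f\<close> with constant \<open>- c\<close>. It
  serves with \<open>c = 0\<close> as the tangent inequality of a convex function and with
  \<open>c = m\<close> as that of a strongly convex one.\<close>

lemma quadratic_lower_bound:
  fixes f :: "'a::real_inner \<Rightarrow> real"
  assumes grad: "\<And>x. GDERIV f x :> g x"
    and bound: "\<And>x y. c * (norm (x - y))\<^sup>2 \<le> (x - y) \<bullet> (g x - g y)"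
  shows "f x + g x \<bullet> (y - x) + c / 2 * (norm (y - x))\<^sup>2 \<le> f y"
proof -
  have "GDERIV (\<lambda>x. - f x) x :> - g x" for x
    using grad by (rule GDERIV_minus)
  moreover have "(x - y) \<bullet> (- g x - - g y) \<le> - c * (norm (x - y))\<^sup>2" for x y
    using bound[of x y] by (simp add: inner_diff_right)
  ultimately have "- f y \<le> - f x + - g x \<bullet> (y - x) + - c / 2 * (norm (y - x))\<^sup>2"
    by (rule quadratic_upper_bound)
  then show ?thesis by simp
qed

text \<open>The Baillon-Haddad argument: \<open>half\<close> sharpens the tangent inequality by a
  squared gradient difference, and adding it to itself with the two points exchanged cancels the
  function values.\<close>

lemma gradient_cocoercive:
  fixes f :: "'a::real_inner \<Rightarrow> real"
  assumes grad: "\<And>x. GDERIV f x :> g x"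
    and K: "0 < K"
    and mono: "\<And>x y. 0 \<le> (x - y) \<bullet> (g x - g y)"
    and bound: "\<And>x y. (x - y) \<bullet> (g x - g y) \<le> K * (norm (x - y))\<^sup>2"
  shows "(norm (g x - g y))\<^sup>2 \<le> K * ((x - y) \<bullet> (g x - g y))"
proof -
  have half: "f w + g w \<bullet> (x - w) + (norm (g x - g w))\<^sup>2 / (2 * K) \<le> f x" for x w
  proof -
    \<comment> \<open>the minimiser over \<open>z\<close> of the quadratic upper bound at \<open>x\<close> minus the linear lower bound at \<open>w\<close>\<close>
    define z where "z = x - (1 / K) *\<^sub>R (g x - g w)"
    have "f w + g w \<bullet> (z - w) \<le> f z"
      using quadratic_lower_bound[of f g 0 w z] grad mono by simp
    also have "f z \<le> f x + g x \<bullet> (z - x) + K / 2 * (norm (z - x))\<^sup>2"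
      by (rule quadratic_upper_bound[OF grad bound])
    finally have "f w + g w \<bullet> (x - w) \<le> f x - (1 / K) * ((g x - g w) \<bullet> (g x - g w))
        + K / 2 * (norm (z - x))\<^sup>2"
      by (simp add: z_def inner_diff_right inner_diff_left algebra_simps)
    moreover have "K / 2 * (norm (z - x))\<^sup>2 = (norm (g x - g w))\<^sup>2 / (2 * K)"
      using K by (simp add: z_def power_divide power2_eq_square)
    moreover have "(1 / K) * ((g x - g w) \<bullet> (g x - g w)) = 2 * ((norm (g x - g w))\<^sup>2 / (2 * K))"
      by (simp add: dot_square_norm)
    ultimately show ?thesis by linarith
  qed
  have "2 * ((norm (g x - g y))\<^sup>2 / (2 * K)) \<le> (x - y) \<bullet> (g x - g y)"
    using half[of y x] half[of x y]
    by (simp add: norm_minus_commute inner_diff_right inner_diff_left inner_commute)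
  then show ?thesis
    using K by (simp add: field_simps)
qed

lemma power2_norm_diff_scaleR:
  fixes v w :: "'a::real_inner"
  shows "(norm (v - c *\<^sub>R w))\<^sup>2 = (norm v)\<^sup>2 - 2 * c * (w \<bullet> v) + c\<^sup>2 * (norm w)\<^sup>2"
  unfolding power2_norm_eq_inner
  by (simp add: inner_diff_left inner_diff_right inner_commute power2_eq_square algebra_simps)

text \<open>Removing \<open>m / 2 * (x \<bullet> x)\<close> from \<open>f\<close> leaves a convex
  \<open>h\<close> whose gradient \<open>k\<close> is cocoercive with constant \<open>L - m\<close>;
  expanding \<open>k\<close> in terms of \<open>g\<close> gives the claim. That constant has to be
  positive, so \<open>m = L\<close> is treated apart.\<close>

lemma gradient_strongly_cocoercive:
  fixes f :: "'a::real_inner \<Rightarrow> real"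
  assumes grad: "\<And>x. GDERIV f x :> g x"
    and params: "0 \<le> m" "m \<le> L"
    and lipschitz: "\<And>x y. norm (g x - g y) \<le> L * norm (x - y)"
    and strong: "\<And>x y. m * (norm (x - y))\<^sup>2 \<le> (x - y) \<bullet> (g x - g y)"
  shows "m * L * (norm (x - y))\<^sup>2 + (norm (g x - g y))\<^sup>2 \<le> (m + L) * ((x - y) \<bullet> (g x - g y))"
proof (cases "m = L")
  case True
  \<comment> \<open>As \<open>m = L\<close>, both terms on the left of the goal are at most
    \<open>L\<^sup>2 * (norm (x - y))\<^sup>2\<close>, which is at most
    \<open>L * ((x - y) \<bullet> (g x - g y))\<close>.\<close>
  have "(norm (g x - g y))\<^sup>2 \<le> (L * norm (x - y))\<^sup>2"
    by (intro power_mono lipschitz) simp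
  moreover have "L * (m * (norm (x - y))\<^sup>2) \<le> L * ((x - y) \<bullet> (g x - g y))"
    using params by (intro mult_left_mono strong) simp
  moreover have "(norm (g x - g y - L *\<^sub>R (x - y)))\<^sup>2
      = (norm (g x - g y))\<^sup>2 - 2 * L * ((x - y) \<bullet> (g x - g y)) + L\<^sup>2 * (norm (x - y))\<^sup>2"
    by (rule power2_norm_diff_scaleR)
  ultimately show ?thesis
    using True by (simp add: power_mult_distrib power2_eq_square algebra_simps)
next
  case False
  define h where "h x = f x - m / 2 * (x \<bullet> x)" for x
  define k where "k x = g x - m *\<^sub>R x" for x
  have k_diff: "(x - y) \<bullet> (k x - k y) = (x - y) \<bullet> (g x - g y) - m * (norm (x - y))\<^sup>2" for x y
    by (simp add: k_def power2_norm_eq_inner inner_diff_left inner_diff_right algebra_simps)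
  have "GDERIV h x :> k x" for x
    unfolding gderiv_def h_def k_def
    by (rule derivative_eq_intros grad[unfolded gderiv_def] refl)+
       (auto simp: fun_eq_iff inner_diff_right inner_commute)
  moreover have "0 < L - m"
    using False params by simp
  moreover have "0 \<le> (x - y) \<bullet> (k x - k y)" for x y
    using strong by (simp add: k_diff)
  moreover have "(x - y) \<bullet> (k x - k y) \<le> (L - m) * (norm (x - y))\<^sup>2" for x y
  proof -
    have "(x - y) \<bullet> (g x - g y) \<le> norm (x - y) * norm (g x - g y)"
      by (rule norm_cauchy_schwarz)
    also have "\<dots> \<le> norm (x - y) * (L * norm (x - y))"
      by (intro mult_left_mono lipschitz) simp
    finally show ?thesis
      unfolding k_diff by (simp add: power2_eq_square algebra_simps)
  qed
  ultimately have "(norm (k x - k y))\<^sup>2 \<le> (L - m) * ((x - y) \<bullet> (k x - k y))"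
    by (rule gradient_cocoercive)
  moreover have "(norm (k x - k y))\<^sup>2
      = (norm (g x - g y))\<^sup>2 - 2 * m * ((x - y) \<bullet> (g x - g y)) + m\<^sup>2 * (norm (x - y))\<^sup>2"
    using power2_norm_diff_scaleR[of "g x - g y" m "x - y"]
    by (simp add: k_def scaleR_diff_right algebra_simps)
  ultimately show ?thesis
    unfolding k_diff by (simp add: power2_eq_square algebra_simps)
qed

section \<open>Quadratic forms of the block matrices\<close>

definition stack :: "'a ^ 'n \<Rightarrow> 'a ^ 'm \<Rightarrow> 'a ^ ('n + 'm)" where
  "stack x y = (\<chi> i. case i of Inl j \<Rightarrow> x $ j | Inr j \<Rightarrow> y $ j)"

lemma sum_UNIV_Plus:
  fixes h :: "'a::finite + 'b::finite \<Rightarrow> 'c::comm_monoid_add"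
  shows "sum h UNIV = (\<Sum>i\<in>UNIV. h (Inl i)) + (\<Sum>j\<in>UNIV. h (Inr j))"
  unfolding UNIV_Plus_UNIV[symmetric] by (subst sum.Plus) auto

lemma inner_stack: "stack x y \<bullet> stack x' y' = x \<bullet> x' + y \<bullet> y'"
  by (simp add: inner_vec_def sum_UNIV_Plus stack_def)

lemma block_mult_stack:
  "block M11 M12 M21 M22 *v stack x y = stack (M11 *v x + M12 *v y) (M21 *v x + M22 *v y)"
  by (simp add: vec_eq_iff matrix_vector_mult_def sum_UNIV_Plus stack_def block_def
      split: sum.split)

lemma inner_vector_matrix_mult:
  fixes M :: "real ^ 'n ^ 'm"
  shows "x \<bullet> (y v* M) = y \<bullet> (M *v x)"
  by (metis dot_lmul_matrix inner_commute)

text \<open>For a state error \<open>x\<close> with velocity \<open>A *v x + B *v v\<close> this is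
  the derivative of \<open>x \<bullet> (P *v x)\<close>; symmetry of \<open>P\<close> merges the two
  cross terms.\<close>

lemma M0_form:
  assumes "transpose P = P"
  shows "stack x v \<bullet> (M0 A B P dP *v stack x v)
    = 2 * ((A *v x + B *v v) \<bullet> (P *v x)) + x \<bullet> (dP *v x)"
proof -
  have sym: "x \<bullet> (P *v z) = z \<bullet> (P *v x)" for x z
    using inner_vector_matrix_mult[of x z P] assms by (metis transpose_matrix_vector)
  show ?thesis
    unfolding M0_def block_mult_stack inner_stack
    by (simp add: matrix_vector_mult_add_rdistrib matrix_vector_mul_assoc[symmetric]
        inner_add_left inner_add_right inner_vector_matrix_mult sym[of x "A *v x"]
        sym[of x "B *v v"] inner_commute[of "P *v x"])
qed

text \<open>The second factor is the velocity of the output \<open>C *v x\<close>, so for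
  \<open>v\<close> the gradient there this is the chain rule for \<open>f (y t)\<close>. The factor
  1/2 in \<open>M1\<close> offsets the symmetrization.\<close>

lemma M1_form:
  "stack x v \<bullet> (M1 A B C dC *v stack x v) = v \<bullet> (dC *v x + C *v (A *v x + B *v v))"
  unfolding M1_def scaleR_matrix_vector_assoc[symmetric] inner_scaleR_right
    block_mult_stack inner_stack
  by (simp add: matrix_vector_mult_add_rdistrib matrix_vector_right_distrib
      matrix_vector_mul_assoc[symmetric] inner_add_right inner_vector_matrix_mult
      inner_commute[of "v v* C"])

text \<open>With \<open>C *v x = y t - ys\<close> and \<open>v\<close> the gradient at
  \<open>y t\<close>, this is the upper bound on \<open>f (y t) - f ys\<close> given by strong
  convexity.\<close>

lemma M2_form:
  "stack x v \<bullet> (M2 m C *v stack x v) = v \<bullet> (C *v x) - m / 2 * (norm (C *v x))\<^sup>2"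
  unfolding M2_def matrix_vector_mul_assoc[symmetric] block_mult_stack inner_stack
  by (simp add: scaleR_matrix_vector_assoc[symmetric] inner_vector_matrix_mult inner_add_right
      inner_commute power2_norm_eq_inner flip: scaleR_minus_left)

text \<open>When \<open>m + L\<close> is positive, multiplying by it gives the slack in
  \<open>gradient_strongly_cocoercive\<close> between the output and \<open>ys\<close>, where the
  gradient vanishes.\<close>

lemma M3_form:
  "stack x v \<bullet> (M3 m L C *v stack x v)
    = v \<bullet> (C *v x) - m * L / (m + L) * (norm (C *v x))\<^sup>2 - (norm v)\<^sup>2 / (m + L)"
  unfolding M3_def matrix_vector_mul_assoc[symmetric] block_mult_stack inner_stack
  by (simp add: scaleR_matrix_vector_assoc[symmetric] inner_vector_matrix_mult inner_add_right
      inner_diff_right inner_commute power2_norm_eq_inner flip: scaleR_minus_left)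

text \<open>Supplies the product rule for \<open>C t *v e t\<close> and
  \<open>P t *v e t\<close>.\<close>

lemma bounded_bilinear_matrix_vector_mult:
  "bounded_bilinear ((*v) :: real ^ 'n ^ 'm \<Rightarrow> real ^ 'n \<Rightarrow> real ^ 'm)"
  unfolding bilinear_conv_bounded_bilinear[symmetric] bilinear_def
  by (auto intro!: linearI simp: matrix_vector_mult_add_rdistrib matrix_vector_right_distrib
      scaleR_matrix_vector_assoc[symmetric] matrix_vector_mult_scaleR)

lemmas has_vector_derivative_matrix_vector_mult =
  bounded_bilinear.has_vector_derivative[OF bounded_bilinear_matrix_vector_mult]

section \<open>Decay of the energy\<close>

theorem theorem6p4:
  fixes t0 m L :: real
    and f :: "real ^ 'd \<Rightarrow> real"
    and A :: "real \<Rightarrow> real ^ 'n ^ 'n"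
    and B :: "real \<Rightarrow> real ^ 'd ^ 'n"
    and C dC :: "real \<Rightarrow> real ^ 'n ^ 'd"
    and \<xi> d\<xi> :: "real \<Rightarrow> real ^ 'n"
    and y u :: "real \<Rightarrow> real ^ 'd"
    and \<xi>s :: "real ^ 'n"
    and ys us :: "real ^ 'd"
    and a da \<sigma> :: "real \<Rightarrow> real"
    and P dP :: "real \<Rightarrow> real ^ 'n ^ 'n"
  assumes dims: "CARD('d) \<le> CARD('n)"
    and params: "0 \<le> m" "m \<le> L" "0 < L"
    and f: "f \<in> smooth_strongly_convex m L"
    and C_deriv: "\<And>t. t \<ge> t0 \<Longrightarrow> (C has_vector_derivative dC t) (at t within {t0..})"
    and \<xi>_deriv: "\<And>t. t \<ge> t0 \<Longrightarrow> (\<xi> has_vector_derivative d\<xi> t) (at t within {t0..})"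
    and dynamics: "\<And>t. t \<ge> t0 \<Longrightarrow> d\<xi> t = A t *v \<xi> t + B t *v u t"
    and output_eq: "\<And>t. t \<ge> t0 \<Longrightarrow> y t = C t *v \<xi> t"
    and feedback: "\<And>t. t \<ge> t0 \<Longrightarrow> u t = gradient f (y t)"
    and fixed_state: "\<And>t. t \<ge> t0 \<Longrightarrow> 0 = A t *v \<xi>s"
    and fixed_output: "\<And>t. t \<ge> t0 \<Longrightarrow> ys = C t *v \<xi>s"
    and fixed_input: "us = gradient f ys" "us = 0"
    and a_nonneg: "\<And>t. t \<ge> t0 \<Longrightarrow> 0 \<le> a t"
    and a_mono: "mono_on {t0..} a"
    and a_deriv: "\<And>t. t \<ge> t0 \<Longrightarrow> (a has_real_derivative da t) (at t within {t0..})"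
    and P_psd: "\<And>t. t \<ge> t0 \<Longrightarrow> pos_semidef (P t)"
    and P_deriv: "\<And>t. t \<ge> t0 \<Longrightarrow> (P has_vector_derivative dP t) (at t within {t0..})"
    and \<sigma>_nonneg: "\<And>t. t \<ge> t0 \<Longrightarrow> 0 \<le> \<sigma> t"
    and \<sigma>_cont: "continuous_on {t0..} \<sigma>"
    and LMI: "\<And>t. t \<ge> t0 \<Longrightarrow>
      neg_semidef (M0 (A t) (B t) (P t) (dP t) + a t *\<^sub>R M1 (A t) (B t) (C t) (dC t)
                   + da t *\<^sub>R M2 m (C t) + \<sigma> t *\<^sub>R M3 m L (C t))"
  shows "\<forall>t \<ge> t0. a t > 0 \<longrightarrow>
    f (y t) - f ys \<le> (a t0 * (f (y t0) - f ys) + (\<xi> t0 - \<xi>s) \<bullet> (P t0 *v (\<xi> t0 - \<xi>s))) / a t"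
proof -
  define g where "g = gradient f"
  have grad: "GDERIV f x :> g x" for x
    using f by (auto simp: g_def smooth_strongly_convex_def intro: GDERIV_gradient)
  have lipschitz: "norm (g x - g z) \<le> L * norm (x - z)" for x z
    using f by (simp add: g_def smooth_strongly_convex_def)
  have strong: "m * (norm (x - z))\<^sup>2 \<le> (x - z) \<bullet> (g x - g z)" for x z
    using f by (simp add: g_def smooth_strongly_convex_def)
  have g_ys: "g ys = 0"
    using fixed_input by (simp add: g_def)
  \<comment> \<open>Since \<open>A t *v \<xi>s = 0\<close>, the error obeys the same dynamics, with
    equilibrium at the origin.\<close>
  define e where "e t = \<xi> t - \<xi>s" for t
  define V where "V t = a t * (f (y t) - f ys) + e t \<bullet> (P t *v e t)" for t
  define dy where "dy t = dC t *v e t + C t *v (A t *v e t + B t *v u t)" for t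
  define dV where "dV t = da t * (f (y t) - f ys) + a t * (u t \<bullet> dy t)
    + (2 * ((A t *v e t + B t *v u t) \<bullet> (P t *v e t)) + e t \<bullet> (dP t *v e t))" for t
  have y_e: "y t = ys + C t *v e t" if "t0 \<le> t" for t
    using that output_eq[of t] fixed_output[of t]
    by (simp add: e_def matrix_vector_mult_diff_distrib)
  have e_deriv: "(e has_vector_derivative A t *v e t + B t *v u t) (at t within {t0..})"
    if "t0 \<le> t" for t
  proof -
    have "d\<xi> t = A t *v e t + B t *v u t"
      using that dynamics[of t] fixed_state[of t]
      by (simp add: e_def matrix_vector_mult_diff_distrib)
    then show ?thesis
      unfolding e_def using \<xi>_deriv[OF that] by (auto intro!: derivative_eq_intros)
  qed
  have y_deriv: "(y has_vector_derivative dy t) (at t within {t0..})" if t: "t0 \<le> t" for t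
  \<comment> \<open>\<open>y\<close> is prescribed only from \<open>t0\<close> on, hence the
    transfer within the half-line. Writing it as \<open>ys + C t *v e t\<close> uses that
    \<open>C t *v \<xi>s\<close> is constant in time.\<close>
  proof (rule has_vector_derivative_transform)
    show "((\<lambda>t. ys + C t *v e t) has_vector_derivative dy t) (at t within {t0..})"
      unfolding dy_def
      using has_vector_derivative_matrix_vector_mult[OF C_deriv[OF t] e_deriv[OF t]]
      by (auto intro!: derivative_eq_intros simp: add.commute)
  qed (use t y_e in auto)
  have V_deriv: "(V has_real_derivative dV t) (at t within {t0..})" if t: "t0 \<le> t" for t
  proof -
    have "((\<lambda>t. f (y t)) has_derivative (\<lambda>h. (h *\<^sub>R dy t) \<bullet> g (y t))) (at t within {t0..})"
      using y_deriv[OF t] grad unfolding has_vector_derivative_def gderiv_def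
      by (rule has_derivative_compose)
    then have fy: "((\<lambda>t. f (y t)) has_real_derivative u t \<bullet> dy t) (at t within {t0..})"
      by (rule has_derivative_imp_has_field_derivative) (simp add: feedback[OF t] g_def inner_commute)
    have sym: "e t \<bullet> (P t *v (A t *v e t + B t *v u t))
        = (A t *v e t + B t *v u t) \<bullet> (P t *v e t)"
      using P_psd[OF t] inner_vector_matrix_mult[of "e t" _ "P t"]
      unfolding pos_semidef_def by (metis transpose_matrix_vector)
    have "((\<lambda>t. e t \<bullet> (P t *v e t)) has_real_derivative
        2 * ((A t *v e t + B t *v u t) \<bullet> (P t *v e t)) + e t \<bullet> (dP t *v e t)) (at t within {t0..})"
      unfolding has_real_derivative_iff_has_vector_derivative
      by (rule has_vector_derivative_eq_rhs, rule bounded_bilinear.has_vector_derivative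
          [OF bounded_bilinear_inner e_deriv[OF t]
            has_vector_derivative_matrix_vector_mult[OF P_deriv[OF t] e_deriv[OF t]]])
        (simp add: inner_add_right[of "e t" "P t *v _"] sym)
    then show ?thesis
      unfolding V_def dV_def
      by (auto intro!: derivative_eq_intros a_deriv[OF t] fy)
  qed
  \<comment> \<open>At interior times the derivative of \<open>a\<close> is two-sided and
    monotonicity gives its sign; the mean value theorem below asks for no more.\<close>
  have dV_nonpos: "dV t \<le> 0" if "t0 < t" for t
  proof -
    have t: "t0 \<le> t" using that by simp
    let ?z = "stack (e t) (u t)"
    have u: "u t = g (y t)"
      using feedback[OF t] by (simp add: g_def)
    have Ce: "C t *v e t = y t - ys"
      using y_e[OF t] by simp
    have "0 \<le> da t"
    proof (rule mono_on_imp_deriv_nonneg[OF a_mono])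
      show "(a has_real_derivative da t) (at t)"
        using a_deriv[OF t] that by (simp add: at_within_interior[of t "{t0..}"])
    qed (use that in simp)
    moreover have "f (y t) - f ys \<le> ?z \<bullet> (M2 m (C t) *v ?z)"
      using quadratic_lower_bound[OF grad strong, of "y t" ys]
      by (simp add: M2_form Ce u inner_diff_right norm_minus_commute)
    ultimately have M2_bound: "da t * (f (y t) - f ys) \<le> da t * (?z \<bullet> (M2 m (C t) *v ?z))"
      by (rule mult_left_mono[rotated])
    have "?z \<bullet> (M3 m L (C t) *v ?z)
        = ((m + L) * (u t \<bullet> (y t - ys)) - m * L * (norm (y t - ys))\<^sup>2 - (norm (u t))\<^sup>2) / (m + L)"
      using params by (simp add: M3_form Ce diff_divide_distrib)
    also have "\<dots> \<ge> 0"
      using gradient_strongly_cocoercive[OF grad params(1,2) lipschitz strong, of "y t" ys] params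
      by (intro divide_nonneg_pos) (simp_all add: u g_ys inner_commute)
    finally have M3_bound: "0 \<le> \<sigma> t * (?z \<bullet> (M3 m L (C t) *v ?z))"
      using \<sigma>_nonneg[OF t] by simp
    have "?z \<bullet> (M0 (A t) (B t) (P t) (dP t) *v ?z) + a t * (?z \<bullet> (M1 (A t) (B t) (C t) (dC t) *v ?z))
        + da t * (?z \<bullet> (M2 m (C t) *v ?z)) + \<sigma> t * (?z \<bullet> (M3 m L (C t) *v ?z)) \<le> 0"
      using LMI[OF t]
      by (simp add: neg_semidef_def matrix_vector_mult_add_rdistrib inner_add_right
          scaleR_matrix_vector_assoc[symmetric])
    \<comment> \<open>\<open>dV t\<close> is the \<open>M0\<close> form plus \<open>a t\<close>
      times the \<open>M1\<close> form plus \<open>da t * (f (y t) - f ys)\<close>; the two bounds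
      place it below the left side of the tested inequality.\<close>
    then show ?thesis
      using M2_bound M3_bound P_psd[OF t]
      by (simp add: M0_form M1_form pos_semidef_def dV_def dy_def)
  qed
  have V_decreasing: "V t \<le> V t0" if "t0 \<le> t" for t
  proof (cases "t = t0")
    case False
    then have "t0 < t" using that by simp
    moreover have "(V has_derivative (*) (dV s)) (at s within {t0..t})"
      if "t0 \<le> s" "s \<le> t" for s
      using V_deriv[of s] that
      by (auto simp: has_field_derivative_def intro: has_derivative_subset)
    ultimately obtain s where s: "s \<in> {t0<..<t}" "V t - V t0 = dV s * (t - t0)"
      using mvt_simple[of t0 t V "\<lambda>s. (*) (dV s)"] by auto
    with dV_nonpos[of s] have "V t - V t0 \<le> 0"
      by (simp add: mult_nonpos_nonneg)
    then show ?thesis by simp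
  qed simp
  show ?thesis
  proof (intro allI impI)
    fix t assume t: "t0 \<le> t" "0 < a t"
    have "0 \<le> e t \<bullet> (P t *v e t)"
      using P_psd[OF t(1)] by (simp add: pos_semidef_def)
    with V_decreasing[OF t(1)] have "a t * (f (y t) - f ys) \<le> V t0"
      by (simp add: V_def)
    then show "f (y t) - f ys
        \<le> (a t0 * (f (y t0) - f ys) + (\<xi> t0 - \<xi>s) \<bullet> (P t0 *v (\<xi> t0 - \<xi>s))) / a t"
      using t(2) by (simp add: V_def e_def field_simps)
  qed
qed

end
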